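(* Let $G$ be an edge-colored complete graph of order $n$ and let $k$ be a positive integer larger than $5$. If $n\geq 8k-18$ and $\delta^c(G)>\frac{n-1}{2}+k$, then $G$ contains a rainbow cycle of length at least $k$.
   Context: All graphs are finite, simple and undirected. An edge-colored graph is a graph $G$ together with an arbitrary mapping $c:E(G)\to\mathbb{N}$ (not required to be a proper coloring). The order of $G$ is $|V(G)|$. The color-degree $d^c_G(v)$ of a vertex $v$ is the number of distinct colors on the edges incident to $v$, and $\delta^c(G)=\min\{d^c_G(v):v\in V(G)\}$ is the minimum color-degree of $G$. A subgraph of $G$ is rainbow if its edges have pairwise distinct colors. The length of a cycle is its number of edges. *)

theory Defs
  imports Complex_Main
begin

type_synonym 'a ugraph = "'a set \<times> 'a set set"

abbreviation vertices :: "'a ugraph \<Rightarrow> 'a set" where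
  "vertices G \<equiv> fst G"

abbreviation edges :: "'a ugraph \<Rightarrow> 'a set set" where
  "edges G \<equiv> snd G"

definition simple_graph :: "'a ugraph \<Rightarrow> bool" where
  "simple_graph G \<longleftrightarrow> finite (vertices G) \<and> (\<forall>e\<in>edges G. e \<subseteq> vertices G \<and> card e = 2)"

definition complete_graph :: "'a ugraph \<Rightarrow> bool" where
  "complete_graph G \<longleftrightarrow> simple_graph G \<and>
     (\<forall>u\<in>vertices G. \<forall>v\<in>vertices G. u \<noteq> v \<longrightarrow> {u, v} \<in> edges G)"

definition order :: "'a ugraph \<Rightarrow> nat" where
  "order G = card (vertices G)"

definition subgraph :: "'a ugraph \<Rightarrow> 'a ugraph \<Rightarrow> bool" where
  "subgraph H G \<longleftrightarrow> simple_graph H \<and> vertices H \<subseteq> vertices G \<and> edges H \<subseteq> edges G"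

text \<open>
  An edge-coloring of G is a function on all sets of vertices; only its values on
  the edges of G are ever used, so it stands for an arbitrary map from the edges
  to the natural numbers.
\<close>

type_synonym 'a edge_coloring = "'a set \<Rightarrow> nat"

definition color_degree :: "'a ugraph \<Rightarrow> 'a edge_coloring \<Rightarrow> 'a \<Rightarrow> nat" where
  "color_degree G c v = card (c ` {e \<in> edges G. v \<in> e})"

text \<open>The minimum is only meaningful for a finite nonempty vertex set.\<close>

definition min_color_degree :: "'a ugraph \<Rightarrow> 'a edge_coloring \<Rightarrow> nat" where
  "min_color_degree G c = Min (color_degree G c ` vertices G)"

definition rainbow :: "'a edge_coloring \<Rightarrow> 'a ugraph \<Rightarrow> bool" where
  "rainbow c H \<longleftrightarrow> inj_on c (edges H)"

text \<open>
  The bound 3 on the number of vertices excludes the closed walk that traverses one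
  edge back and forth.
\<close>

definition is_cycle :: "'a ugraph \<Rightarrow> bool" where
  "is_cycle C \<longleftrightarrow> (\<exists>vs. 3 \<le> length vs \<and> distinct vs \<and> vertices C = set vs \<and>
     edges C = {{vs ! i, vs ! (Suc i mod length vs)} | i. i < length vs})"

definition cycle_length :: "'a ugraph \<Rightarrow> nat" where
  "cycle_length C = card (edges C)"

end

theory Submission
  imports Defs
begin

text \<open>
  Suppose that no rainbow cycle has at least $k$ vertices, and let $v_0 \ldots v_{m-1}$ be a
  longest rainbow path, with $e_i$ the color of $v_i v_{i+1}$. Each end of the path sees at least
  $n/2 + k$ colors, so if both ends together see few colors there is a contradiction. The path is
  what makes few colors available.

  Maximality forces every edge from an end to a vertex outside the path to repeat a path color.
  A chord $v_0 v_j$ with $j \ge k-1$ closes a long cycle and therefore repeats some $e_i$ with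
  $i < j$. So all but $k-3$ of the colors at $v_0$, and likewise at $v_{m-1}$, are path
  colors. Writing $S$ and $T$ for the path colors seen (in a controlled position) at the two ends,
  this gives $|S| + |T| \ge n + 2k - 2(k-3) = n + 6$, and also $m \ge n/2 + 4 \ge 4k - 5$; this
  last inequality is the reason for the bound $n \ge 8k - 18$.

  On the other hand $|S| + |T| = |S \cup T| + |S \cap T| \le (m-1) + |S \cap T|$, and the point of the
  proof is that $S \cap T$ has at most $(n-m) + 6$ elements, whence $|S| + |T| \le n + 5$. A common
  color is of one of two kinds.

  It may be carried at both ends by chords of the path. If $v_0 v_j$ has color $e_i$ and
  $v_{m-1} v_l$ has color $e_{i'}$ with $l \le i' < i < j$, then
  $v_0 \ldots v_l v_{m-1} \ldots v_j v_0$ is a rainbow cycle, hence short, so the two chords are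
  nearly as long as the path. Together with the way in which the color of a long chord propagates to
  shorter chords, this leaves room for only two common chord colors
  (\<open>card_common_chords\<close>).

  Otherwise, at one of the ends, it is carried only by edges to vertices outside the path. There are
  $n - m$ such vertices $x$, and each contributes at most one common color unless $v_0 x$ and $v_{m-1} x$
  have different colors, neither of which is the color of a chord at the same end. Then rainbow detours
  through $v_{m-1} x v_0$ show that one of the two colors lies in a fixed set of four
  (\<open>two_new_colors_exceptional\<close>). So there are at most $(n-m) + 4$ colors of this
  kind (\<open>card_common_colors\<close>).
\<close>

section \<open>Color sequences of paths and cycles\<close>

fun path_colors :: "'a edge_coloring \<Rightarrow> 'a list \<Rightarrow> nat list" where
  "path_colors c (x # y # zs) = c {x, y} # path_colors c (y # zs)"
| "path_colors c zs = []"

lemma path_colors_append: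
  assumes "xs \<noteq> []" "ys \<noteq> []"
  shows "path_colors c (xs @ ys) = path_colors c xs @ c {last xs, hd ys} # path_colors c ys"
  using assms
proof (induction xs rule: induct_list012)
  case (2 x)
  then show ?case by (cases ys) auto
qed auto

lemma path_colors_upt:
  "path_colors c (map p [a..<b]) = map (\<lambda>i. c {p i, p (Suc i)}) [a..<b - 1]"
proof (induction b)
  case (Suc b)
  show ?case
  proof (cases "a < b")
    case True
    then have "[a..<b] = [a..<b - 1] @ [b - 1]"
      using upt_Suc_append[of a "b - 1"] by simp
    then show ?thesis
      using True Suc path_colors_append[of "map p [a..<b]" "[p b]" c] by simp
  qed auto
qed simp

lemma path_colors_rev: "path_colors c (rev xs) = rev (path_colors c xs)"
proof (induction xs rule: induct_list012)
  case (3 x y zs)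
  then show ?case
    using path_colors_append[of "rev (y # zs)" "[x]" c] by (simp add: insert_commute)
qed auto

text \<open>
  Cycles are given by their vertex sequences throughout; the color of the closing edge comes first, which
  makes the coloring of a concatenation of path segments easy to compute.
\<close>

definition rainbow_closed :: "'a edge_coloring \<Rightarrow> 'a list \<Rightarrow> bool" where
  "rainbow_closed c vs \<longleftrightarrow> distinct (c {last vs, hd vs} # path_colors c vs)"

lemma rainbow_closed_imp_cycle:
  assumes "complete_graph G" "set vs \<subseteq> vertices G" "distinct vs" "3 \<le> length vs"
    and rb: "rainbow_closed c vs"
  shows "\<exists>C. subgraph C G \<and> is_cycle C \<and> rainbow c C \<and> cycle_length C = length vs"
proof -
  define n where "n = length vs"
  define E where "E i = {vs ! i, vs ! (Suc i mod n)}" for i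
  define C where "C = (set vs, E ` {..<n})"
  have n3: "3 \<le> n" using assms by (simp add: n_def)
  have "map (\<lambda>i. c (E i)) [0..<n] = map (\<lambda>i. c (E i)) [0..<n - 1] @ [c (E (n - 1))]"
    using n3 upt_Suc_append[of 0 "n - 1"] by simp
  also have "c (E (n - 1)) = c {last vs, hd vs}"
  proof -
    have "Suc (n - 1) = n" "vs \<noteq> []" using n3 by (auto simp: n_def)
    then show ?thesis by (simp add: E_def last_conv_nth hd_conv_nth flip: n_def)
  qed
  also have "map (\<lambda>i. c (E i)) [0..<n - 1] = path_colors c vs"
    using path_colors_upt[of c "(!) vs" 0 n] by (auto simp: map_nth n_def E_def)
  finally have "distinct (map (\<lambda>i. c (E i)) [0..<n])"
    using rb by (auto simp: rainbow_closed_def)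
  then have inj: "inj_on (c \<circ> E) {..<n}"
    by (simp add: distinct_map atLeast0LessThan comp_def)
  then have injE: "inj_on E {..<n}" by (rule inj_on_imageI2)
  have E: "E i \<in> edges G \<and> E i \<subseteq> set vs \<and> card (E i) = 2" if "i < n" for i
  proof -
    have "Suc i mod n < n" using n3 by simp
    moreover have "Suc i mod n \<noteq> i" using that n3 by (cases "Suc i = n") auto
    ultimately have "vs ! i \<noteq> vs ! (Suc i mod n)" "vs ! i \<in> set vs" "vs ! (Suc i mod n) \<in> set vs"
      using that assms(3) by (auto simp: n_def nth_eq_iff_index_eq)
    then show ?thesis
      using assms(1,2) by (auto simp: E_def complete_graph_def)
  qed
  have "subgraph C G"
    using E assms(2) by (auto simp: subgraph_def simple_graph_def C_def)
  moreover have "is_cycle C"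
    unfolding is_cycle_def C_def using assms n3
    by (intro exI[of _ vs]) (auto simp: E_def n_def)
  moreover have "rainbow c C"
    using inj by (auto simp: rainbow_def C_def intro: inj_on_imageI)
  moreover have "cycle_length C = length vs"
    using injE by (simp add: cycle_length_def C_def card_image n_def)
  ultimately show ?thesis by blast
qed

section \<open>A longest rainbow path\<close>

text \<open>
  The vertices are indexed from \<open>0\<close> to \<open>m - 1\<close>. Maximality enters only through the two facts
  that the path cannot be prolonged at either end, so that these assumptions are invariant under
  reversal of the path and every statement about the start yields one about the end.
\<close>

locale longest_rainbow_path =
  fixes V :: "'a set" and c :: "'a edge_coloring" and k m :: nat and p :: "nat \<Rightarrow> 'a"
  assumes finite_V: "finite V"
    and k_ge: "3 \<le> k"
    and m_pos: "0 < m"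
    and p_in_V: "p ` {..<m} \<subseteq> V"
    and inj_p: "inj_on p {..<m}"
    and inj_colors: "inj_on (\<lambda>i. c {p i, p (Suc i)}) {..<m - 1}"
    and start_stuck: "\<And>x. x \<in> V - p ` {..<m} \<Longrightarrow> \<exists>i<m - 1. c {p 0, x} = c {p i, p (Suc i)}"
    and end_stuck: "\<And>x. x \<in> V - p ` {..<m} \<Longrightarrow> \<exists>i<m - 1. c {p (m - 1), x} = c {p i, p (Suc i)}"
    and no_long_cycle:
      "\<And>vs. set vs \<subseteq> V \<Longrightarrow> distinct vs \<Longrightarrow> k \<le> length vs \<Longrightarrow> \<not> rainbow_closed c vs"
begin

definition e :: "nat \<Rightarrow> nat" where
  "e i = c {p i, p (Suc i)}"

abbreviation outside :: "'a set" where
  "outside \<equiv> V - p ` {..<m}"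

text \<open>
  Path colors are represented by their indices along the path. A chord from the start counts only if its
  color occurs before its other endpoint, and a chord from the end only if its color
  occurs after its other endpoint: then the color of the chord lies on the segment that the
  chord closes to a cycle, and is free again when a detour along the chord skips that segment.
\<close>

definition start_chords :: "nat set" where
  "start_chords = {i. \<exists>j. i < j \<and> j < m \<and> c {p 0, p j} = e i}"

definition end_chords :: "nat set" where
  "end_chords = {i. i < m - 1 \<and> (\<exists>l\<le>i. c {p (m - 1), p l} = e i)}"

definition start_colors :: "nat set" where
  "start_colors = start_chords \<union> {i. i < m - 1 \<and> (\<exists>x\<in>outside. c {p 0, x} = e i)}"

definition end_colors :: "nat set" where
  "end_colors = end_chords \<union> {i. i < m - 1 \<and> (\<exists>x\<in>outside. c {p (m - 1), x} = e i)}"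

lemma inj_e: "inj_on e {..<m - 1}"
  using inj_colors by (simp add: e_def[abs_def])

lemma e_eq_iff: "i < m - 1 \<Longrightarrow> j < m - 1 \<Longrightarrow> e i = e j \<longleftrightarrow> i = j"
  using inj_e by (auto dest: inj_onD)

lemma p_eq_iff: "i < m \<Longrightarrow> j < m \<Longrightarrow> p i = p j \<longleftrightarrow> i = j"
  using inj_p by (auto dest: inj_onD)

lemma path_colors_p: "path_colors c (map p [a..<b]) = map e [a..<b - 1]"
  by (simp add: path_colors_upt e_def)

lemma image_reversed: "(\<lambda>i. p (m - 1 - i)) ` {..<m} = p ` {..<m}"
proof -
  have "(\<lambda>i. m - 1 - i) ` {..<m} = {..<m}"
  proof (intro equalityI subsetI)
    fix x assume "x \<in> {..<m}"
    then show "x \<in> (\<lambda>i. m - 1 - i) ` {..<m}"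
      by (intro image_eqI[of _ _ "m - 1 - x"]) auto
  qed auto
  then show ?thesis by (metis image_image)
qed

lemma reversed_edge:
  assumes "i < m - 1"
  shows "c {p (m - 1 - i), p (m - 1 - Suc i)} = e (m - 2 - i)"
proof -
  have "Suc (m - 2 - i) = m - 1 - i" "m - 1 - Suc i = m - 2 - i" using assms by auto
  then show ?thesis by (metis e_def insert_commute)
qed

lemma reversed: "longest_rainbow_path V c k m (\<lambda>i. p (m - 1 - i))"
proof -
  have ex: "\<exists>i<m - 1. a = c {p (m - 1 - i), p (m - 1 - Suc i)}"
    if a: "\<exists>i<m - 1. a = c {p i, p (Suc i)}" for a
  proof -
    obtain i where i: "i < m - 1" "a = e i" using a unfolding e_def by blast
    then have "m - 2 - (m - 2 - i) = i" by auto
    with i show ?thesis using reversed_edge[of "m - 2 - i"]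
      by (intro exI[of _ "m - 2 - i"]) auto
  qed
  show ?thesis
  proof (unfold_locales, unfold image_reversed)
    show "inj_on (\<lambda>i. p (m - 1 - i)) {..<m}"
      by (auto simp: inj_on_def p_eq_iff)
    show "inj_on (\<lambda>i. c {p (m - 1 - i), p (m - 1 - Suc i)}) {..<m - 1}"
    proof (rule inj_onI)
      fix i j assume ij: "i \<in> {..<m - 1}" "j \<in> {..<m - 1}"
        and "c {p (m - 1 - i), p (m - 1 - Suc i)} = c {p (m - 1 - j), p (m - 1 - Suc j)}"
      then have "e (m - 2 - i) = e (m - 2 - j)" using reversed_edge by simp
      then have "m - 2 - i = m - 2 - j" using ij by (subst (asm) e_eq_iff) auto
      then show "i = j" using ij by (auto dest: diff_diff_cancel)
    qed
    show "\<exists>i<m - 1. c {p (m - 1 - 0), x} = c {p (m - 1 - i), p (m - 1 - Suc i)}"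
      if "x \<in> outside" for x
      using ex[OF end_stuck[OF that]] by simp
    show "\<exists>i<m - 1. c {p (m - 1 - (m - 1)), x} = c {p (m - 1 - i), p (m - 1 - Suc i)}"
      if "x \<in> outside" for x
      using ex[OF start_stuck[OF that]] by simp
  qed (use finite_V k_ge m_pos p_in_V no_long_cycle in auto)
qed

lemma reversed_e:
  assumes "i < m - 1"
  shows "longest_rainbow_path.e c (\<lambda>i. p (m - 1 - i)) i = e (m - 2 - i)"
  using longest_rainbow_path.e_def[OF reversed] reversed_edge[OF assms] by simp

lemma reversed_e_mirror:
  assumes "i < m - 1"
  shows "longest_rainbow_path.e c (\<lambda>i. p (m - 1 - i)) (m - 2 - i) = e i"
proof -
  have "m - 2 - (m - 2 - i) = i" "m - 2 - i < m - 1" using assms by auto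
  then show ?thesis using reversed_e by metis
qed

text \<open>
  Every cycle considered below, apart from those of \<open>start_chord_backward\<close>, uses path colors only,
  so its rainbowness reduces to the distinctness of a list of indices.
\<close>

lemma no_cycle_of_path_colors:
  assumes "distinct vs" "set vs \<subseteq> V" "k \<le> length vs"
    and "c {last vs, hd vs} # path_colors c vs = map e is"
    and "set is \<subseteq> {..<m - 1}" "distinct is"
  shows False
proof -
  have "rainbow_closed c vs"
    using assms(4-6) inj_e unfolding rainbow_closed_def
    by (metis distinct_map inj_on_subset)
  then show False using no_long_cycle assms(1-3) by blast
qed

lemma p_mem: "i < m \<Longrightarrow> p i \<in> V"
  using p_in_V by auto

section \<open>Chords at the two ends\<close>

text \<open>
  Otherwise the initial segment of the path up to \<open>p j\<close> would close up to a long rainbow cycle.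
\<close>

lemma start_chord_backward:
  assumes "k \<le> j + 1" "j < m"
  shows "\<exists>i<j. c {p 0, p j} = e i"
proof (rule ccontr)
  assume neg: "\<not> ?thesis"
  let ?vs = "map p [0..<j + 1]"
  have "distinct ?vs"
    using assms by (auto simp: distinct_map inj_on_def p_eq_iff)
  moreover have "set ?vs \<subseteq> V" using assms by (auto intro: p_mem)
  moreover have "distinct (map e [0..<j])"
    using assms by (auto simp: distinct_map inj_on_def e_eq_iff)
  then have "rainbow_closed c ?vs"
    using neg path_colors_p[of 0 "j + 1"]
    by (auto simp: rainbow_closed_def hd_map last_map insert_commute simp del: upt_Suc)
  ultimately show False using no_long_cycle[of ?vs] assms by simp
qed

lemma end_chord_forward:
  assumes "l + k \<le> m"
  shows "\<exists>i. l \<le> i \<and> i < m - 1 \<and> c {p (m - 1), p l} = e i"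
proof -
  interpret rev: longest_rainbow_path V c k m "\<lambda>i. p (m - 1 - i)" by (rule reversed)
  have l: "l < m" "m - 1 - (m - 1 - l) = l" using assms k_ge by auto
  have "k \<le> m - 1 - l + 1" "m - 1 - l < m" using assms k_ge by auto
  from rev.start_chord_backward[OF this]
  obtain i where "i < m - 1 - l" "c {p (m - 1), p l} = rev.e i"
    unfolding l(2) by auto
  with l show ?thesis
    using reversed_e[of i] by (intro exI[of _ "m - 2 - i"]) auto
qed

text \<open>
  The cycle runs from the start to \<open>p l\<close>, jumps to the end of the path, runs back to \<open>p j\<close> and
  returns to the start. It skips the segment between \<open>p l\<close> and \<open>p j\<close>, which contains the edges of
  both colors \<open>e i\<close> and \<open>e i'\<close>, so it is rainbow; the bound is on its number of vertices.
\<close>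

lemma crossing_chords_short:
  assumes "c {p 0, p j} = e i" "i < j" "j < m"
    and "c {p (m - 1), p l} = e i'" "l \<le> i'" "i' < i"
  shows "l + 1 + (m - j) < k"
proof (rule ccontr)
  assume "\<not> ?thesis"
  let ?vs = "map p [0..<l + 1] @ rev (map p [j..<m])"
  let ?is = "i # [0..<l] @ i' # rev [j..<m - 1]"
  have "distinct ?vs" "set ?vs \<subseteq> V"
    using assms by (auto simp: distinct_map inj_on_def p_eq_iff p_mem)
  moreover have "k \<le> length ?vs" using \<open>\<not> l + 1 + (m - j) < k\<close> assms by simp
  moreover have "c {last ?vs, hd ?vs} # path_colors c ?vs = map e ?is"
  proof -
    have "hd ?vs = p 0" by (simp add: hd_append hd_map del: upt_Suc)
    moreover have "last ?vs = p j" using assms by (simp add: last_rev hd_map)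
    moreover have "last (map p [0..<l + 1]) = p l" by simp
    moreover have "hd (rev (map p [j..<m])) = p (m - 1)"
      using assms by (simp add: hd_rev last_map)
    moreover have "path_colors c ?vs =
        path_colors c (map p [0..<l + 1]) @ c {last (map p [0..<l + 1]), hd (rev (map p [j..<m]))}
          # path_colors c (rev (map p [j..<m]))"
      using assms by (intro path_colors_append) auto
    moreover have "path_colors c (rev (map p [j..<m])) = rev (map e [j..<m - 1])"
      by (simp only: path_colors_rev path_colors_p)
    ultimately show ?thesis
      using assms(1,4) by (simp add: path_colors_p rev_map insert_commute del: upt_Suc)
  qed
  moreover have "set ?is \<subseteq> {..<m - 1}" "distinct ?is" using assms by auto
  ultimately show False by (rule no_cycle_of_path_colors)
qed

text \<open>
  The cycle consists of the two chords from the start to \<open>p a\<close> and \<open>p j\<close> and the path segment between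
  their endpoints, whose colors have index at least \<open>a\<close>. The colors of both chords have smaller
  index, so the cycle can fail to be rainbow only if they agree.
\<close>

lemma start_chord_color_propagates:
  assumes "c {p 0, p j} = e i" "i < j" "j < m"
    and "i < a" "k \<le> a + 1" "a + k \<le> j + 2"
  shows "c {p 0, p a} = e i"
proof (rule ccontr)
  assume neq: "c {p 0, p a} \<noteq> e i"
  obtain i' where i': "i' < a" "c {p 0, p a} = e i'"
    using start_chord_backward[of a] assms k_ge by auto
  let ?vs = "p 0 # map p [a..<j + 1]"
  let ?is = "i # i' # [a..<j]"
  have aj: "a < j" "0 < a" using assms k_ge by auto
  have "distinct ?vs" "set ?vs \<subseteq> V"
    using assms aj by (auto simp: distinct_map inj_on_def p_eq_iff p_mem)
  moreover have "k \<le> length ?vs" using assms aj by simp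
  moreover have "c {last ?vs, hd ?vs} # path_colors c ?vs = map e ?is"
    using aj assms(1) i' path_colors_append[of "[p 0]" "map p [a..<j + 1]" c] path_colors_p[of a "j + 1"]
    by (simp add: hd_map insert_commute)
  moreover have "set ?is \<subseteq> {..<m - 1}" "distinct ?is" using assms i' neq aj by auto
  ultimately show False by (rule no_cycle_of_path_colors)
qed

text \<open>
  By the bound on crossing chords, every chord from the start with color \<open>e i\<close> ends among the last
  \<open>k - 2\<close> vertices. If \<open>i\<close> were not large itself, the color would propagate to a shorter chord,
  which does not end there.
\<close>

lemma start_chord_above_end_chord:
  assumes "3 * k \<le> m + 5"
    and "c {p 0, p j} = e i" "i < j" "j < m"
    and "c {p (m - 1), p l} = e i'" "l \<le> i'" "i' < i"
  shows "m + 4 \<le> i + 2 * k"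
proof (rule ccontr)
  assume small: "\<not> ?thesis"
  \<comment> \<open>The least index above \<open>i\<close> at which the color of a chord is known to occur earlier on the path.\<close>
  define a where "a = max (i + 1) (k - 1)"
  have j: "m + 2 \<le> j + k" using crossing_chords_short[OF assms(2-)] by simp
  have a: "i < a" "k \<le> a + 1" "a + k \<le> j + 2"
    using small j assms(1) k_ge by (auto simp: a_def)
  have "c {p 0, p a} = e i"
    using start_chord_color_propagates[OF assms(2-4) a] .
  then have "m + 2 \<le> a + k"
    using crossing_chords_short[of a i l i'] assms a k_ge by simp
  then show False using a assms(4) by simp
qed

lemma end_chord_below_start_chord:
  assumes "3 * k \<le> m + 5"
    and "c {p 0, p j} = e i" "i < j" "j < m"
    and "c {p (m - 1), p l} = e i'" "l \<le> i'" "i' < i"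
  shows "i' + 6 \<le> 2 * k"
proof -
  interpret rev: longest_rainbow_path V c k m "\<lambda>i. p (m - 1 - i)" by (rule reversed)
  have im: "i < m - 1" "i' < m - 1" "m - 1 - (m - 1 - l) = l" "m - 1 - (m - 1 - j) = j"
    using assms by auto
  have "c {p (m - 1 - 0), p (m - 1 - (m - 1 - l))} = rev.e (m - 2 - i')"
    "c {p (m - 1 - (m - 1)), p (m - 1 - (m - 1 - j))} = rev.e (m - 2 - i)"
    unfolding reversed_e_mirror[OF im(1)] reversed_e_mirror[OF im(2)] im(3,4)
    using assms by auto
  moreover have "m - 2 - i' < m - 1 - l" "m - 1 - l < m" "m - 1 - j \<le> m - 2 - i"
    "m - 2 - i < m - 2 - i'"
    using assms im by auto
  ultimately have "m + 4 \<le> m - 2 - i' + 2 * k"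
    using rev.start_chord_above_end_chord[OF assms(1)] by blast
  then show ?thesis using im by linarith
qed

text \<open>
  Of three common indices the middle one is both the larger of a pair and the smaller of a pair. It
  is then at least \<open>m + 4 - 2 * k\<close> and at most \<open>2 * k - 6\<close>, which is impossible on a path this long.
\<close>

lemma card_common_chords:
  assumes "4 * k \<le> m + 5"
  shows "card (start_chords \<inter> end_chords) \<le> 2"
proof (rule ccontr)
  let ?I = "start_chords \<inter> end_chords"
  assume "\<not> ?thesis"
  then have ge3: "3 \<le> card ?I" by simp
  have fin: "finite ?I" by (simp add: end_chords_def)
  obtain i1 i2 i3 where i: "i1 \<in> ?I" "i2 \<in> ?I" "i3 \<in> ?I" "i1 < i2" "i2 < i3"
  proof -
    obtain A where A: "A \<subseteq> ?I" "card A = 3" "finite A"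
      using obtain_subset_with_card_n[OF ge3] by metis
    obtain x y z where "A = {x, y, z}" "x \<noteq> y" "y \<noteq> z" "x \<noteq> z"
      using A(2) by (auto simp: card_3_iff)
    then show thesis using A(1) that[of x y z] that[of x z y] that[of y x z] that[of y z x]
        that[of z x y] that[of z y x] by (metis insert_subset linorder_neqE_nat)
  qed
  have k: "3 * k \<le> m + 5" using assms by simp
  have "m + 4 \<le> i2 + 2 * k"
    using i start_chord_above_end_chord[OF k] by (auto simp: start_chords_def end_chords_def)
  moreover have "i2 + 6 \<le> 2 * k"
    using i end_chord_below_start_chord[OF k] by (auto simp: start_chords_def end_chords_def)
  ultimately show False using assms by simp
qed

section \<open>Vertices outside the path\<close>

text \<open>
  The cycle takes the first \<open>k - 2\<close> vertices of the path, the end of the path, and \<open>x\<close>. As it uses only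
  the first \<open>k - 3\<close> edges of the path, the colors of the two edges at \<open>x\<close> and of the chord
  are free, so the chord must share its color with an edge at \<open>x\<close>; it cannot be \<open>e i'\<close>, which no
  chord from the end carries.
\<close>

lemma detour_small_colors:
  assumes "2 * k \<le> m + 3"
    and x: "x \<in> outside" "c {p 0, x} = e i" "c {p (m - 1), x} = e i'"
    and i: "i < m - 1" "i' < m - 1" "i \<noteq> i'" "k \<le> i + 3" "k \<le> i' + 3" "i' \<notin> end_chords"
  shows "c {p (m - 1), p (k - 3)} = e i"
proof (rule ccontr)
  assume neq: "\<not> ?thesis"
  obtain q where q: "k - 3 \<le> q" "q < m - 1" "c {p (m - 1), p (k - 3)} = e q"
    using end_chord_forward[of "k - 3"] assms(1) k_ge by force
  let ?vs = "map p [0..<k - 2] @ [p (m - 1), x]"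
  let ?is = "i # [0..<k - 3] @ [q, i']"
  have qi': "q \<noteq> i'" using q i by (auto simp: end_chords_def)
  have "distinct ?vs" "set ?vs \<subseteq> V"
    using assms(1) x k_ge by (auto simp: distinct_map inj_on_def p_eq_iff p_mem)
  moreover have "k \<le> length ?vs" by simp
  moreover have "c {last ?vs, hd ?vs} # path_colors c ?vs = map e ?is"
    using path_colors_append[of "map p [0..<k - 2]" "[p (m - 1), x]" c] path_colors_p[of 0 "k - 2"]
      k_ge q x by (simp add: hd_map last_map insert_commute)
  moreover have "set ?is \<subseteq> {..<m - 1}" "distinct ?is"
    using i q qi' neq assms(1) by auto
  ultimately show False by (rule no_cycle_of_path_colors)
qed


lemma detour_large_colors:
  assumes "2 * k \<le> m + 3"
    and x: "x \<in> outside" "c {p 0, x} = e i" "c {p (m - 1), x} = e i'"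
    and i: "i < m - 1" "i' < m - 1" "i \<noteq> i'" "i + k \<le> m + 1" "i' + k \<le> m + 1" "i \<notin> start_chords"
  shows "c {p 0, p (m + 2 - k)} = e i'"
proof -
  interpret rev: longest_rainbow_path V c k m "\<lambda>i. p (m - 1 - i)" by (rule reversed)
  have "m - 2 - i \<notin> rev.end_chords"
  proof
    assume "m - 2 - i \<in> rev.end_chords"
    then obtain l where "l \<le> m - 2 - i" "c {p 0, p (m - 1 - l)} = rev.e (m - 2 - i)"
      unfolding rev.end_chords_def by auto
    then have "i < m - 1 - l \<and> m - 1 - l < m \<and> c {p 0, p (m - 1 - l)} = e i"
      using i reversed_e_mirror[OF i(1)] by auto
    then show False using i(6) unfolding start_chords_def by blast
  qed
  moreover have "m - 1 - (k - 3) = m + 2 - k" using k_ge by simp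
  moreover have "x \<in> V - (\<lambda>i. p (m - 1 - i)) ` {..<m}"
    unfolding image_reversed by (rule x(1))
  moreover have "c {p (m - 1 - 0), x} = rev.e (m - 2 - i')"
    "c {p (m - 1 - (m - 1)), x} = rev.e (m - 2 - i)"
    using x i unfolding reversed_e_mirror[OF i(1)] reversed_e_mirror[OF i(2)] by auto
  moreover have "m - 2 - i' < m - 1" "m - 2 - i < m - 1" "m - 2 - i' \<noteq> m - 2 - i"
    "k \<le> m - 2 - i' + 3" "k \<le> m - 2 - i + 3"
    using i by auto
  ultimately have "c {p (m - 1 - (m - 1)), p (m - 1 - (k - 3))} = rev.e (m - 2 - i')"
    using rev.detour_small_colors[OF assms(1)] by blast
  then show ?thesis
    using \<open>m - 1 - (k - 3) = m + 2 - k\<close> reversed_e_mirror[OF i(2)] by simp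
qed

text \<open>
  When both colors at \<open>x\<close> avoid the middle segment from \<open>p (k - 1)\<close> to \<open>p (m - k)\<close>, this segment is
  closed to a cycle by two chords and the detour \<open>p (m - 1)\<close>, \<open>x\<close>, \<open>p 0\<close>. The chord from
  the end has a color after the segment and the chord from the start has one before it, so the only possible
  coincidences are those with the edges at \<open>x\<close>.
\<close>

lemma detour_extreme_colors:
  assumes "3 * k \<le> m + 5" "2 * k \<le> m + 1"
    and x: "x \<in> outside" "c {p 0, x} = e i" "c {p (m - 1), x} = e i'"
    and i: "i < m - 1" "i' < m - 1" "i \<noteq> i'" "i \<notin> {k - 1..<m - k}" "i' \<notin> {k - 1..<m - k}"
      "i \<notin> start_chords" "i' \<notin> end_chords"
  shows "c {p (m - 1), p (m - k)} = e i \<or> c {p 0, p (k - 1)} = e i'"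
proof (rule ccontr)
  assume neq: "\<not> ?thesis"
  obtain q where q: "m - k \<le> q" "q < m - 1" "c {p (m - 1), p (m - k)} = e q"
    using end_chord_forward[of "m - k"] assms(2) k_ge by auto
  obtain r where r: "r < k - 1" "c {p 0, p (k - 1)} = e r"
    using start_chord_backward[of "k - 1"] assms(2) k_ge by force
  let ?vs = "map p [k - 1..<m - k + 1] @ [p (m - 1), x, p 0]"
  let ?is = "r # [k - 1..<m - k] @ [q, i', i]"
  have "q \<noteq> i'" using q i by (auto simp: end_chords_def)
  moreover have "r \<noteq> i" using r i assms(2) k_ge by (fastforce simp: start_chords_def)
  moreover have "q \<noteq> i" "r \<noteq> i'" using neq q r by auto
  ultimately have dist: "distinct ?is" using i q r assms(2) by auto
  have "r < m - 1" using r assms(2) k_ge by linarith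
  have le: "k - 1 \<le> m - k" using assms(2) k_ge by linarith
  have "distinct ?vs" "set ?vs \<subseteq> V"
    using assms(2) x k_ge by (auto simp: distinct_map inj_on_def p_eq_iff p_mem)
  moreover have "k \<le> length ?vs"
  proof -
    have "length ?vs = m - k + 1 - (k - 1) + 3" by (simp del: upt_Suc)
    then show ?thesis using assms(1,2) k_ge by linarith
  qed
  moreover have "c {last ?vs, hd ?vs} # path_colors c ?vs = map e ?is"
    using path_colors_append[of "map p [k - 1..<m - k + 1]" "[p (m - 1), x, p 0]" c]
      path_colors_p[of "k - 1" "m - k + 1"] le q r x
    by (simp add: hd_map hd_append last_map insert_commute del: upt_Suc)
  moreover have "set ?is \<subseteq> {..<m - 1}" using i q \<open>r < m - 1\<close> assms(2) by auto
  ultimately show False using dist by (rule no_cycle_of_path_colors)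
qed

text \<open>
  If both indices are at least \<open>k - 3\<close>, or both are at most \<open>m + 1 - k\<close>, the detour along an initial
  or a final segment applies. Otherwise one index is small and the other is large, hence
  neither is in the middle.
\<close>

lemma two_new_colors_exceptional:
  assumes "3 * k \<le> m + 5" "2 * k \<le> m + 1"
    and x: "x \<in> outside" "c {p 0, x} = e i" "c {p (m - 1), x} = e i'"
    and i: "i < m - 1" "i' < m - 1" "i \<noteq> i'" "i \<notin> start_chords" "i' \<notin> end_chords"
  shows "e i \<in> {c {p (m - 1), p (k - 3)}, c {p (m - 1), p (m - k)}} \<or>
    e i' \<in> {c {p 0, p (m + 2 - k)}, c {p 0, p (k - 1)}}"
proof (cases "k \<le> i + 3 \<and> k \<le> i' + 3")
  case True
  then show ?thesis using detour_small_colors[of x i i'] assms by simp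
next
  case small: False
  show ?thesis
  proof (cases "i + k \<le> m + 1 \<and> i' + k \<le> m + 1")
    case True
    then show ?thesis using detour_large_colors[of x i i'] assms by simp
  next
    case False
    then have "i \<notin> {k - 1..<m - k} \<and> i' \<notin> {k - 1..<m - k}" using small by auto
    then show ?thesis using detour_extreme_colors[of x i i'] assms by auto
  qed
qed

lemma card_outside: "card outside + m = card V"
proof -
  have "card (p ` {..<m}) = m" using inj_p by (simp add: card_image)
  moreover have "card (p ` {..<m}) \<le> card V" using finite_V p_in_V by (rule card_mono)
  ultimately show ?thesis using p_in_V by (simp add: card_Diff_subset)
qed

lemma card_common_colors:
  assumes "4 * k \<le> m + 5"
  shows "card (start_colors \<inter> end_colors) \<le> card outside + 6"
proof -
  define F where "F = {c {p (m - 1), p (k - 3)}, c {p (m - 1), p (m - k)},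
    c {p 0, p (m + 2 - k)}, c {p 0, p (k - 1)}}"
  define X where "X = {i. i < m - 1 \<and> e i \<in> F}"
  define Q where "Q = start_colors \<inter> end_colors - (start_chords \<inter> end_chords) - X"
  \<comment> \<open>Each index in \<open>Q\<close> is charged to an outside vertex that carries its color to an end lacking it as
    a chord color; no vertex is charged twice, since one of the two indices would be in \<open>X\<close>.\<close>
  have "\<forall>q\<in>Q. \<exists>x. x \<in> outside \<and> (q \<notin> start_chords \<and> c {p 0, x} = e q \<or>
      q \<notin> end_chords \<and> c {p (m - 1), x} = e q)"
    unfolding Q_def start_colors_def end_colors_def by blast
  then obtain h where h: "\<And>q. q \<in> Q \<Longrightarrow> h q \<in> outside"
    "\<And>q. q \<in> Q \<Longrightarrow> q \<notin> start_chords \<and> c {p 0, h q} = e q \<or>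
      q \<notin> end_chords \<and> c {p (m - 1), h q} = e q"
    by metis
  have Q: "q < m - 1" "e q \<notin> F" if "q \<in> Q" for q
    using that by (auto simp: Q_def X_def end_colors_def end_chords_def)
  have k: "3 * k \<le> m + 5" "2 * k \<le> m + 1" using assms k_ge by auto
  have clash: False if "q \<in> Q" "q' \<in> Q" "q \<noteq> q'" "h q = h q'"
    "q \<notin> start_chords" "c {p 0, h q} = e q" "q' \<notin> end_chords" "c {p (m - 1), h q'} = e q'" for q q'
    using two_new_colors_exceptional[OF k, of "h q" q q'] that h Q
    by (auto simp: F_def)
  have "inj_on h Q"
  proof (rule inj_onI, rule ccontr)
    fix q q' assume q: "q \<in> Q" "q' \<in> Q" "h q = h q'" "q \<noteq> q'"
    then have "e q \<noteq> e q'" using Q e_eq_iff by blast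
    then show False using clash[of q q'] clash[of q' q] h(2)[of q] h(2)[of q'] q by metis
  qed
  then have "card Q \<le> card outside"
    using h(1) finite_V by (intro card_inj_on_le[of h]) auto
  moreover have "card X \<le> 4"
  proof -
    have "card X \<le> card F"
      using inj_e by (intro card_inj_on_le[of e]) (auto simp: X_def F_def intro: inj_on_subset)
    also have "\<dots> \<le> 4"
      using card_length[of "[c {p (m - 1), p (k - 3)}, c {p (m - 1), p (m - k)},
        c {p 0, p (m + 2 - k)}, c {p 0, p (k - 1)}]"] by (simp add: F_def)
    finally show ?thesis .
  qed
  moreover have "card (start_chords \<inter> end_chords) \<le> 2"
    using card_common_chords[OF assms] .
  moreover have "start_colors \<inter> end_colors \<subseteq> (start_chords \<inter> end_chords) \<union> X \<union> Q"
    by (auto simp: Q_def)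
  then have "card (start_colors \<inter> end_colors) \<le> card ((start_chords \<inter> end_chords) \<union> X \<union> Q)"
    by (intro card_mono) (auto simp: end_chords_def X_def Q_def end_colors_def)
  moreover have "card ((start_chords \<inter> end_chords) \<union> X \<union> Q)
      \<le> card (start_chords \<inter> end_chords) + card X + card Q"
    by (meson add_le_mono1 card_Un_le order_trans)
  ultimately show ?thesis by simp
qed

section \<open>Counting colors at the two ends\<close>

text \<open>
  The only vertices whose edge to the start can have an uncontrolled color are \<open>p 2\<close> to \<open>p (k - 2)\<close>:
  vertices outside the path repeat a path color by maximality, and \<open>p j\<close> with \<open>j \<ge> k - 1\<close> by
  \<open>start_chord_backward\<close>.
\<close>

lemma card_colors_at_start:
  "card ((\<lambda>u. c {p 0, u}) ` (V - {p 0})) \<le> card start_colors + (k - 3)"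
proof -
  have "(\<lambda>u. c {p 0, u}) ` (V - {p 0}) \<subseteq> e ` start_colors \<union> (\<lambda>j. c {p 0, p j}) ` {2..<k - 1}"
  proof (rule image_subsetI)
    fix u assume u: "u \<in> V - {p 0}"
    show "c {p 0, u} \<in> e ` start_colors \<union> (\<lambda>j. c {p 0, p j}) ` {2..<k - 1}"
    proof (cases "u \<in> outside")
      case True
      then show ?thesis using start_stuck[of u] by (fastforce simp: start_colors_def e_def)
    next
      case False
      then obtain j where j: "j < m" "u = p j" using u by auto
      have "j \<noteq> 0" using j u by (metis DiffE insertI1)
      consider "j = 1" | "j \<in> {2..<k - 1}" | "k \<le> j + 1" using \<open>j \<noteq> 0\<close> by force
      then show ?thesis
      proof cases
        case 1
        then have "c {p 0, u} = e 0" "0 \<in> start_chords"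
          using j by (auto simp: start_chords_def e_def intro!: exI[of _ 1])
        then show ?thesis by (auto simp: start_colors_def)
      next
        case 3
        then obtain i where "i < j" "c {p 0, u} = e i" using start_chord_backward j by metis
        then show ?thesis using j by (auto simp: start_colors_def start_chords_def)
      qed (use j in auto)
    qed
  qed
  moreover have fin: "finite start_colors"
    by (rule finite_subset[of _ "{..<m}"]) (auto simp: start_colors_def start_chords_def)
  ultimately have "card ((\<lambda>u. c {p 0, u}) ` (V - {p 0}))
      \<le> card (e ` start_colors \<union> (\<lambda>j. c {p 0, p j}) ` {2..<k - 1})"
    by (intro card_mono) auto
  also have "\<dots> \<le> card (e ` start_colors) + card ((\<lambda>j. c {p 0, p j}) ` {2..<k - 1})"
    by (rule card_Un_le)
  also have "\<dots> \<le> card start_colors + (k - 3)"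
    using card_image_le[OF fin, of e] card_image_le[of "{2..<k - 1}" "\<lambda>j. c {p 0, p j}"] by simp
  finally show ?thesis .
qed

lemma card_colors_at_end:
  "card ((\<lambda>u. c {p (m - 1), u}) ` (V - {p (m - 1)})) \<le> card end_colors + (k - 3)"
proof -
  interpret rev: longest_rainbow_path V c k m "\<lambda>i. p (m - 1 - i)" by (rule reversed)
  have sub: "rev.start_colors \<subseteq> (\<lambda>i. m - 2 - i) ` end_colors"
  proof
    fix i assume i: "i \<in> rev.start_colors"
    then have im: "i < m - 1" unfolding rev.start_colors_def rev.start_chords_def by auto
    have "m - 2 - i \<in> end_colors"
    proof (cases "i \<in> rev.start_chords")
      case True
      then obtain j where "i < j" "j < m" "c {p (m - 1), p (m - 1 - j)} = e (m - 2 - i)"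
        using reversed_e[OF im] unfolding rev.start_chords_def by auto
      then show ?thesis
        by (auto simp: end_colors_def end_chords_def intro!: exI[of _ "m - 1 - j"])
    next
      case False
      then obtain x where "x \<in> outside" "c {p (m - 1 - 0), x} = rev.e i"
        using i unfolding rev.start_colors_def image_reversed by blast
      then have "x \<in> outside" "c {p (m - 1), x} = e (m - 2 - i)"
        using reversed_e[OF im] by auto
      then show ?thesis using im by (auto simp: end_colors_def)
    qed
    then show "i \<in> (\<lambda>i. m - 2 - i) ` end_colors"
      using im by (intro image_eqI[of _ _ "m - 2 - i"]) auto
  qed
  have fin: "finite end_colors" by (simp add: end_colors_def end_chords_def)
  have "card rev.start_colors \<le> card end_colors"
    using surj_card_le[OF fin sub] .
  then show ?thesis using rev.card_colors_at_start by simp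
qed

lemma large_color_degrees_impossible:
  assumes "\<And>v. v \<in> V \<Longrightarrow> card V + 2 * k \<le> 2 * card ((\<lambda>u. c {v, u}) ` (V - {v}))"
    and "8 * k \<le> card V + 18"
  shows False
proof -
  have sub: "start_colors \<subseteq> {..<m - 1}" "end_colors \<subseteq> {..<m - 1}"
    by (auto simp: start_colors_def start_chords_def end_colors_def end_chords_def)
  have fin: "finite start_colors" "finite end_colors"
    using sub finite_subset by blast+
  have S: "card V + 6 \<le> 2 * card start_colors"
    using assms(1)[of "p 0"] card_colors_at_start m_pos p_mem[of 0] k_ge by simp
  have T: "card V + 6 \<le> 2 * card end_colors"
    using assms(1)[of "p (m - 1)"] card_colors_at_end m_pos p_mem[of "m - 1"] k_ge by simp
  have "card start_colors \<le> m - 1"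
    using card_mono[OF _ sub(1)] by simp
  then have m: "4 * k \<le> m + 5" using S m_pos assms(2) by linarith
  have "card start_colors + card end_colors
      = card (start_colors \<union> end_colors) + card (start_colors \<inter> end_colors)"
    using fin by (rule card_Un_Int)
  also have "\<dots> \<le> (m - 1) + (card outside + 6)"
    using card_mono[of "{..<m - 1}" "start_colors \<union> end_colors"] sub card_common_colors[OF m]
    by simp
  also have "\<dots> = card V + 5" using card_outside m_pos by simp
  finally show False using S T by simp
qed

end

section \<open>Existence of a longest rainbow path\<close>

lemma longest_rainbow_path_exists:
  assumes "finite V" "V \<noteq> {}" "3 \<le> k"
    and no_cycle: "\<And>vs. set vs \<subseteq> V \<Longrightarrow> distinct vs \<Longrightarrow> k \<le> length vs \<Longrightarrow> \<not> rainbow_closed c vs"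
  shows "\<exists>m p. longest_rainbow_path V c k m p"
proof -
  define R where "R vs \<longleftrightarrow> set vs \<subseteq> V \<and> distinct vs \<and> distinct (path_colors c vs)" for vs
  obtain v where "v \<in> V" using assms(2) by auto
  then have "R [v]" by (simp add: R_def)
  moreover have "length vs \<le> card V" if "R vs" for vs
    using that assms(1) by (metis R_def card_mono distinct_card)
  ultimately obtain vs where vs: "R vs" and max: "\<And>ws. R ws \<Longrightarrow> length ws \<le> length vs"
    using ex_has_greatest_nat[of R "[v]" length "Suc (card V)"] by (auto simp: less_Suc_eq_le)
  have "vs \<noteq> []" using max[OF \<open>R [v]\<close>] by auto
  define e where "e i = c {vs ! i, vs ! Suc i}" for i
  have colors: "path_colors c vs = map e [0..<length vs - 1]"
    using path_colors_upt[of c "(!) vs" 0 "length vs"] by (simp add: map_nth e_def)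
  have img: "(!) vs ` {..<length vs} = set vs"
    by (auto simp: in_set_conv_nth)
  have in_path: "\<exists>i<length vs - 1. a = e i" if "a \<in> set (path_colors c vs)" for a
    using that by (auto simp: colors)
  have start: "c {hd vs, x} \<in> set (path_colors c vs)" if x: "x \<in> V - set vs" for x
  proof (rule ccontr)
    assume "\<not> ?thesis"
    then have "R (x # vs)"
      using vs x path_colors_append[of "[x]" vs c] \<open>vs \<noteq> []\<close> by (simp add: R_def insert_commute)
    then show False using max by fastforce
  qed
  have stop: "c {last vs, x} \<in> set (path_colors c vs)" if x: "x \<in> V - set vs" for x
  proof (rule ccontr)
    assume "\<not> ?thesis"
    then have "R (vs @ [x])"
      using vs x path_colors_append[of vs "[x]" c] \<open>vs \<noteq> []\<close> by (simp add: R_def)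
    then show False using max by fastforce
  qed
  have "longest_rainbow_path V c k (length vs) ((!) vs)"
  proof (unfold_locales, unfold img)
    show "inj_on ((!) vs) {..<length vs}"
      using vs by (auto simp: R_def inj_on_def nth_eq_iff_index_eq)
    show "inj_on (\<lambda>i. c {vs ! i, vs ! Suc i}) {..<length vs - 1}"
      using vs colors by (simp add: R_def distinct_map atLeast0LessThan e_def[abs_def])
    show "\<exists>i<length vs - 1. c {vs ! 0, x} = c {vs ! i, vs ! Suc i}" if "x \<in> V - set vs" for x
      using in_path[OF start[OF that]] \<open>vs \<noteq> []\<close> by (simp add: hd_conv_nth e_def)
    show "\<exists>i<length vs - 1. c {vs ! (length vs - 1), x} = c {vs ! i, vs ! Suc i}"
      if "x \<in> V - set vs" for x
      using in_path[OF stop[OF that]] \<open>vs \<noteq> []\<close> by (simp add: last_conv_nth e_def)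
  qed (use assms vs \<open>vs \<noteq> []\<close> in \<open>auto simp: R_def\<close>)
  then show ?thesis by blast
qed

lemma color_degree_complete:
  assumes "complete_graph G" "v \<in> vertices G"
  shows "color_degree G c v = card ((\<lambda>u. c {v, u}) ` (vertices G - {v}))"
proof -
  have "{e \<in> edges G. v \<in> e} = (\<lambda>u. {v, u}) ` (vertices G - {v})"
  proof (intro equalityI subsetI)
    fix e assume "e \<in> {e \<in> edges G. v \<in> e}"
    then have e: "e \<subseteq> vertices G" "card e = 2" "v \<in> e"
      using assms(1) by (auto simp: complete_graph_def simple_graph_def)
    then obtain u where "e = {v, u}" "u \<noteq> v" by (auto simp: card_2_iff)
    then show "e \<in> (\<lambda>u. {v, u}) ` (vertices G - {v})" using e by auto
  qed (use assms in \<open>auto simp: complete_graph_def\<close>)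
  then show ?thesis by (simp add: color_degree_def image_image)
qed

theorem theorem1p11:
  fixes G :: "'a ugraph" and c :: "'a edge_coloring" and n k :: nat
  assumes "complete_graph G"
    and "order G = n"
    and "k > 5"
    and "int n \<ge> 8 * int k - 18"
    and "real (min_color_degree G c) > (real n - 1) / 2 + real k"
  shows "\<exists>C. subgraph C G \<and> is_cycle C \<and> rainbow c C \<and> cycle_length C \<ge> k"
proof (rule ccontr)
  assume none: "\<not> ?thesis"
  define V where "V = vertices G"
  have V: "finite V" "card V = n"
    using assms(1,2) by (auto simp: V_def complete_graph_def simple_graph_def order_def)
  have n: "8 * k \<le> n + 18" using assms(4) by linarith
  then have "V \<noteq> {}" using V assms(3) by auto
  have "\<not> rainbow_closed c vs" if vs: "set vs \<subseteq> V" "distinct vs" "k \<le> length vs" for vs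
  proof
    assume "rainbow_closed c vs"
    moreover have "3 \<le> length vs" using vs(3) assms(3) by simp
    ultimately obtain C where
      "subgraph C G" "is_cycle C" "rainbow c C" "cycle_length C = length vs"
      using rainbow_closed_imp_cycle[OF assms(1)] vs(1,2) unfolding V_def by blast
    then show False using none vs(3) by metis
  qed
  then obtain m p where P: "longest_rainbow_path V c k m p"
    using longest_rainbow_path_exists[of V k c] V \<open>V \<noteq> {}\<close> assms(3) by auto
  have "card V + 2 * k \<le> 2 * card ((\<lambda>u. c {v, u}) ` (V - {v}))" if "v \<in> V" for v
  proof -
    have "min_color_degree G c \<le> color_degree G c v"
      using that V(1) by (simp add: min_color_degree_def V_def)
    moreover have "real n - 1 + 2 * real k < 2 * real (min_color_degree G c)"
      using assms(5) by argo
    ultimately have "n + 2 * k \<le> 2 * color_degree G c v" by linarith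
    then show ?thesis
      using color_degree_complete[OF assms(1)] that V by (simp add: V_def)
  qed
  then show False
    using longest_rainbow_path.large_color_degrees_impossible[OF P] n V assms(3) by simp
qed

end
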